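(* Let $ABCD$ be a quadrangle in the Euclidean plane whose diagonals are not parallel, and for $\lambda\in\mathbb{R}$ let $p^{\lambda}$ denote the perimeter of the homothetic parallelogram $K^{\lambda}L^{\lambda}M^{\lambda}N^{\lambda}$ of $ABCD$ with ratio $\lambda$. Then for all $\lambda_1,\lambda_2\in\mathbb{R}$, $$\frac{p^{\lambda_1}}{p^{\lambda_2}}=\frac{|\lambda_1-1|}{|\lambda_2-1|},$$ where for $\lambda_2=1$ the equality is understood formally, in cross-multiplied form $p^{\lambda_1}|\lambda_2-1|=p^{\lambda_2}|\lambda_1-1|$ with $p^{\lambda_2}=0$.
   Context: A quadrangle $ABCD$ consists of four points $A,B,C,D$ of the Euclidean plane, no three collinear, taken in this cyclic order; its sides are the segments $AB,BC,CD,DA$, and it may be convex, re-entrant (non-convex and not self-intersecting) or crossed (self-intersecting). The lines $AC$ and $BD$ are its diagonals, and $O$ is their intersection point. For points $X,Y$ and $\lambda\in\mathbb{R}$, $X_Y^{\lambda}$ denotes the image of $Y$ under the homothety with center $X$ and ratio $\lambda$, i.e. $X_Y^{\lambda}=X+\lambda(Y-X)$. The homothetic parallelogram of $ABCD$ with ratio $\lambda$ is the parallelogram $K^{\lambda}L^{\lambda}M^{\lambda}N^{\lambda}$ whose vertices are the intersections of lines $K^{\lambda}=A_B^{\lambda}A_D^{\lambda}\cap B_A^{\lambda}B_C^{\lambda}$, $L^{\lambda}=B_A^{\lambda}B_C^{\lambda}\cap C_B^{\lambda}C_D^{\lambda}$, $M^{\lambda}=C_B^{\lambda}C_D^{\lambda}\cap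 D_A^{\lambda}D_C^{\lambda}$, $N^{\lambda}=D_A^{\lambda}D_C^{\lambda}\cap A_B^{\lambda}A_D^{\lambda}$. Its perimeter is $|K^{\lambda}L^{\lambda}|+|L^{\lambda}M^{\lambda}|+|M^{\lambda}N^{\lambda}|+|N^{\lambda}K^{\lambda}|$. Convention for $\lambda=0$: the lines are understood as limits as $\lambda\to0$: $A_B^{0}A_D^{0}$ is the line through $A$ parallel to $BD$, $B_A^{0}B_C^{0}$ the line through $B$ parallel to $AC$, $C_B^{0}C_D^{0}$ the line through $C$ parallel to $BD$, $D_A^{0}D_C^{0}$ the line through $D$ parallel to $AC$. For $\lambda=1$ the parallelogram degenerates to the point $O$ (perimeter $0$). *)

theory Defs
  imports "HOL-Analysis.Analysis"
begin

type_synonym point = "real ^ 2"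

definition quadrangle :: "point \<Rightarrow> point \<Rightarrow> point \<Rightarrow> point \<Rightarrow> bool" where
  "quadrangle A B C D \<longleftrightarrow>
     \<not> collinear {A, B, C} \<and> \<not> collinear {A, B, D} \<and>
     \<not> collinear {A, C, D} \<and> \<not> collinear {B, C, D}"

definition line :: "point \<Rightarrow> point \<Rightarrow> point set" where
  "line X Y = affine hull {X, Y}"

definition homothety :: "point \<Rightarrow> real \<Rightarrow> point \<Rightarrow> point" where
  "homothety X \<mu> Y = X + \<mu> *\<^sub>R (Y - X)"

(* For a vertex X with adjacent vertices Y and Z: the line joining the images of Y and Z
   under the homothety with centre X and ratio \<mu>.  For \<mu> = 0 both images are X and the
   line is, by convention, the limit as \<mu> tends to 0: the parallel to YZ through X. *)
definition side_line :: "point \<Rightarrow> point \<Rightarrow> point \<Rightarrow> real \<Rightarrow> point set" where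
  "side_line X Y Z \<mu> =
     (if \<mu> = 0 then {X + t *\<^sub>R (Z - Y) | t. True}
      else line (homothety X \<mu> Y) (homothety X \<mu> Z))"

(* Only meaningful when the two lines meet in exactly one point. *)
definition meet :: "point set \<Rightarrow> point set \<Rightarrow> point" where
  "meet l m = (THE P. l \<inter> m = {P})"

definition K_pt :: "point \<Rightarrow> point \<Rightarrow> point \<Rightarrow> point \<Rightarrow> real \<Rightarrow> point" where
  "K_pt A B C D \<mu> = meet (side_line A B D \<mu>) (side_line B A C \<mu>)"

definition L_pt :: "point \<Rightarrow> point \<Rightarrow> point \<Rightarrow> point \<Rightarrow> real \<Rightarrow> point" where
  "L_pt A B C D \<mu> = meet (side_line B A C \<mu>) (side_line C B D \<mu>)"

definition M_pt :: "point \<Rightarrow> point \<Rightarrow> point \<Rightarrow> point \<Rightarrow> real \<Rightarrow> point" where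
  "M_pt A B C D \<mu> = meet (side_line C B D \<mu>) (side_line D A C \<mu>)"

definition N_pt :: "point \<Rightarrow> point \<Rightarrow> point \<Rightarrow> point \<Rightarrow> real \<Rightarrow> point" where
  "N_pt A B C D \<mu> = meet (side_line D A C \<mu>) (side_line A B D \<mu>)"

definition perimeter :: "point \<Rightarrow> point \<Rightarrow> point \<Rightarrow> point \<Rightarrow> real \<Rightarrow> real" where
  "perimeter A B C D \<mu> =
     dist (K_pt A B C D \<mu>) (L_pt A B C D \<mu>) + dist (L_pt A B C D \<mu>) (M_pt A B C D \<mu>) +
     dist (M_pt A B C D \<mu>) (N_pt A B C D \<mu>) + dist (N_pt A B C D \<mu>) (K_pt A B C D \<mu>)"

end

theory Submission
  imports Defs
begin

text \<open>Let the diagonals have directions \<open>u = C - A\<close> and \<open>v = D - B\<close> and meet in \<open>O\<close>.  The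
  line \<open>side_line X Y Z \<mu>\<close> is the parallel to the diagonal \<open>YZ\<close> through \<open>X + \<mu> (Y - X)\<close>, that
  is, the image of the parallel through \<open>X\<close> under the homothety with centre \<open>O\<close> and ratio
  \<open>1 - \<mu>\<close>.  Hence the sides of the homothetic parallelogram are \<open>(1 - \<mu>) u\<close> and
  \<open>(1 - \<mu>) v\<close>, and its perimeter is \<open>2 \<bar>1 - \<mu>\<bar> (\<bar>u\<bar> + \<bar>v\<bar>)\<close>.\<close>

lemma line_eq: "line X Y = {X + t *\<^sub>R (Y - X) | t. True}"
  unfolding line_def affine_hull_2
proof (intro set_eqI iffI; clarify)
  fix a b :: real
  assume "a + b = 1"
  then have "a = 1 - b" by simp
  then have "a *\<^sub>R X + b *\<^sub>R Y = X + b *\<^sub>R (Y - X)"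
    by (simp only:) (simp add: algebra_simps)
  then show "\<exists>t. a *\<^sub>R X + b *\<^sub>R Y = X + t *\<^sub>R (Y - X) \<and> True" by blast
next
  fix t :: real
  have "X + t *\<^sub>R (Y - X) = (1 - t) *\<^sub>R X + t *\<^sub>R Y" by (simp add: algebra_simps)
  then show "\<exists>a b. X + t *\<^sub>R (Y - X) = a *\<^sub>R X + b *\<^sub>R Y \<and> a + b = 1"
    by (metis diff_add_cancel)
qed

text \<open>The images of \<open>Y\<close> and \<open>Z\<close> differ by \<mu> times
  \<open>Z - Y\<close>, and for \<mu> \<noteq> 0 this factor is absorbed into the parameter. The
  limit convention for \<mu> = 0 fits the same formula, so no later argument splits on the
  ratio.\<close>

lemma side_line_eq: "side_line X Y Z \<mu> = {X + \<mu> *\<^sub>R (Y - X) + t *\<^sub>R (Z - Y) | t. True}"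
proof (cases "\<mu> = 0")
  case True
  then show ?thesis by (simp add: side_line_def)
next
  case False
  have "homothety X \<mu> Y + t *\<^sub>R (homothety X \<mu> Z - homothety X \<mu> Y)
      = X + \<mu> *\<^sub>R (Y - X) + (t * \<mu>) *\<^sub>R (Z - Y)" for t
    by (simp add: homothety_def algebra_simps)
  moreover have "{f (t * \<mu>) | t. True} = {f t | t. True}" for f :: "real \<Rightarrow> point"
  proof (intro set_eqI iffI; clarify)
    fix t
    have "f t = f (t / \<mu> * \<mu>)" using False by simp
    then show "\<exists>t'. f t = f (t' * \<mu>) \<and> True" by blast
  qed blast
  ultimately show ?thesis
    using False unfolding side_line_def line_eq by simp
qed

text \<open>Used in contrapositive form, to turn non-parallel diagonals into linearly independent
  direction vectors.\<close>

lemma line_affine_parallel: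
  assumes "D - B = k *\<^sub>R (C - A)" "k \<noteq> 0"
  shows "affine_parallel (line A C) (line B D)"
  unfolding affine_parallel_def
proof (intro exI set_eqI iffI)
  fix x
  assume "x \<in> line B D"
  then obtain t where "x = B + t *\<^sub>R (D - B)" by (auto simp: line_eq)
  then have "x = (B - A) + (A + (t * k) *\<^sub>R (C - A))" using assms by simp
  then show "x \<in> (\<lambda>y. (B - A) + y) ` line A C" unfolding line_eq by blast
next
  fix x
  assume "x \<in> (\<lambda>y. (B - A) + y) ` line A C"
  then obtain t where "x = (B - A) + (A + t *\<^sub>R (C - A))" unfolding line_eq by blast
  then have "x = B + (t / k) *\<^sub>R (D - B)" using assms by simp
  then show "x \<in> line B D" unfolding line_eq by blast
qed

text \<open>In coordinates with origin \<open>Q\<close> and basis \<open>u\<close>,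
  \<open>v\<close>, the line \<open>l\<close> fixes the first coordinate and \<open>m\<close> the
  second, so exactly one point is common and the description in \<open>meet\<close> is well-defined.
  The condition \<open>u \<noteq> v\<close> keeps \<open>{u, v}\<close> from collapsing to a
  singleton, which could be independent.\<close>

lemma meet_eq:
  fixes u v Q :: point
  assumes "independent {u, v}" "u \<noteq> v"
    and l: "l = {Q + x *\<^sub>R u + t *\<^sub>R v | t. True}"
    and m: "m = {Q + y *\<^sub>R v + t *\<^sub>R u | t. True}"
  shows "meet l m = Q + x *\<^sub>R u + y *\<^sub>R v"
proof -
  have zero: "a = 0 \<and> b = 0" if "a *\<^sub>R u + b *\<^sub>R v = 0" for a b
  proof -
    have "v \<noteq> 0" "u \<notin> span {v}"
      using assms(1,2) by (auto simp: independent_insert)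
    have "a *\<^sub>R u = (- b) *\<^sub>R v"
      using that by (simp add: add_eq_0_iff2)
    then have "a *\<^sub>R u \<in> span {v}"
      by (simp only: span_base span_scale singletonI)
    then have "a = 0"
      using \<open>u \<notin> span {v}\<close> span_scale[of "a *\<^sub>R u" "{v}" "inverse a"] by (cases "a = 0") auto
    then show ?thesis
      using that \<open>v \<noteq> 0\<close> by simp
  qed
  have "l \<inter> m = {Q + x *\<^sub>R u + y *\<^sub>R v}"
  proof (intro set_eqI iffI)
    fix z
    assume "z \<in> l \<inter> m"
    then obtain s t where z: "z = Q + x *\<^sub>R u + s *\<^sub>R v" "z = Q + y *\<^sub>R v + t *\<^sub>R u"
      unfolding l m by blast
    then have "(x - t) *\<^sub>R u + (s - y) *\<^sub>R v = 0" by (simp add: algebra_simps)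
    then have "s = y" using zero by fastforce
    then show "z \<in> {Q + x *\<^sub>R u + y *\<^sub>R v}" using z by simp
  next
    fix z
    assume z: "z \<in> {Q + x *\<^sub>R u + y *\<^sub>R v}"
    then have "z = Q + y *\<^sub>R v + x *\<^sub>R u" by (simp add: algebra_simps)
    with z show "z \<in> l \<inter> m" unfolding l m by blast
  qed
  then show ?thesis by (simp add: meet_def the_equality)
qed

lemma perimeter_eq:
  assumes ind: "independent {C - A, D - B}" "C - A \<noteq> D - B"
  shows "perimeter A B C D \<mu> = 2 * \<bar>\<mu> - 1\<bar> * (norm (C - A) + norm (D - B))"
proof -
  define u v where uv: "u = C - A" "v = D - B"
  have ind': "independent {u, v}" "u \<noteq> v" using ind by (simp_all add: uv)
  \<comment> \<open>Two independent vectors span the plane, by dimension.\<close>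
  have "B - A \<in> span {u, v}"
    using card_ge_dim_independent[of "{u, v}" UNIV] ind' by auto
  then obtain s t where "B - A = s *\<^sub>R u + t *\<^sub>R v"
    by (auto simp: span_insert span_singleton algebra_simps)
  \<comment> \<open>The sign of \<open>t\<close> is switched so that \<open>A\<close> and
    \<open>B\<close> get the symmetric forms \<open>Q - s u\<close> and \<open>Q - t v\<close>
    below.\<close>
  then have "B = A + s *\<^sub>R u - (- t) *\<^sub>R v" by (simp add: algebra_simps)
  then obtain t where B: "B = A + s *\<^sub>R u - t *\<^sub>R v" by blast
  \<comment> \<open>\<open>Q\<close> lies on both diagonals: it is the point \<open>O\<close> of the
    overview.\<close>
  define Q where "Q = A + s *\<^sub>R u"
  have pts: "A = Q - s *\<^sub>R u" "B = Q - t *\<^sub>R v" "C = Q + (1 - s) *\<^sub>R u" "D = Q + (1 - t) *\<^sub>R v"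
    using B by (simp_all add: Q_def uv algebra_simps)
  define r where "r = 1 - \<mu>"
  \<comment> \<open>A constant multiple of the direction only shifts the parameter. This removes the
    terms with coefficients \<open>- \<mu> * t\<close> and \<open>- \<mu> * s\<close> below, leaving
    offsets from \<open>Q\<close> proportional to \<open>r\<close>.\<close>
  have shift: "{P + c *\<^sub>R w + t *\<^sub>R w | t. True} = {P + t *\<^sub>R w | t. True}" for P w :: point and c
  proof -
    have "(\<exists>t. z = P + (c + t) *\<^sub>R w) \<longleftrightarrow> (\<exists>t. z = P + t *\<^sub>R w)" for z
    proof
      assume "\<exists>t. z = P + t *\<^sub>R w"
      then obtain t where "z = P + (c + (t - c)) *\<^sub>R w" by auto
      then show "\<exists>t. z = P + (c + t) *\<^sub>R w" by blast
    qed blast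
    then show ?thesis by (simp add: scaleR_left_distrib add.assoc)
  qed
  have "side_line A B D \<mu> = {(Q + (- r * s) *\<^sub>R u) + (- \<mu> * t) *\<^sub>R v + \<tau> *\<^sub>R v | \<tau>. True}"
    unfolding side_line_eq uv(2)[symmetric] by (simp add: pts r_def algebra_simps)
  then have a: "side_line A B D \<mu> = {Q + (- r * s) *\<^sub>R u + \<tau> *\<^sub>R v | \<tau>. True}"
    unfolding shift .
  have "side_line B A C \<mu> = {(Q + (- r * t) *\<^sub>R v) + (- \<mu> * s) *\<^sub>R u + \<tau> *\<^sub>R u | \<tau>. True}"
    unfolding side_line_eq uv(1)[symmetric] by (simp add: pts r_def algebra_simps)
  then have b: "side_line B A C \<mu> = {Q + (- r * t) *\<^sub>R v + \<tau> *\<^sub>R u | \<tau>. True}"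
    unfolding shift .
  have "side_line C B D \<mu> = {(Q + (r * (1 - s)) *\<^sub>R u) + (- \<mu> * t) *\<^sub>R v + \<tau> *\<^sub>R v | \<tau>. True}"
    unfolding side_line_eq uv(2)[symmetric] by (simp add: pts r_def algebra_simps)
  then have c: "side_line C B D \<mu> = {Q + (r * (1 - s)) *\<^sub>R u + \<tau> *\<^sub>R v | \<tau>. True}"
    unfolding shift .
  have "side_line D A C \<mu> = {(Q + (r * (1 - t)) *\<^sub>R v) + (- \<mu> * s) *\<^sub>R u + \<tau> *\<^sub>R u | \<tau>. True}"
    unfolding side_line_eq uv(1)[symmetric] by (simp add: pts r_def algebra_simps)
  then have d: "side_line D A C \<mu> = {Q + (r * (1 - t)) *\<^sub>R v + \<tau> *\<^sub>R u | \<tau>. True}"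
    unfolding shift .
  \<comment> \<open>\<open>meet_eq\<close> expects the line with direction \<open>u\<close> second,
    whereas \<open>L_pt\<close> and \<open>N_pt\<close> list it first.\<close>
  have meet_commute: "meet l m = meet m l" for l m by (simp add: meet_def Int_commute)
  have K: "K_pt A B C D \<mu> = Q + (- r * s) *\<^sub>R u + (- r * t) *\<^sub>R v"
    unfolding K_pt_def by (rule meet_eq[OF ind' a b])
  have L: "L_pt A B C D \<mu> = Q + (r * (1 - s)) *\<^sub>R u + (- r * t) *\<^sub>R v"
    unfolding L_pt_def by (subst meet_commute, rule meet_eq[OF ind' c b])
  have M: "M_pt A B C D \<mu> = Q + (r * (1 - s)) *\<^sub>R u + (r * (1 - t)) *\<^sub>R v"
    unfolding M_pt_def by (rule meet_eq[OF ind' c d])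
  have N: "N_pt A B C D \<mu> = Q + (- r * s) *\<^sub>R u + (r * (1 - t)) *\<^sub>R v"
    unfolding N_pt_def by (subst meet_commute, rule meet_eq[OF ind' a d])
  have sides:
    "K_pt A B C D \<mu> - L_pt A B C D \<mu> = - r *\<^sub>R u"
    "L_pt A B C D \<mu> - M_pt A B C D \<mu> = - r *\<^sub>R v"
    "M_pt A B C D \<mu> - N_pt A B C D \<mu> = r *\<^sub>R u"
    "N_pt A B C D \<mu> - K_pt A B C D \<mu> = r *\<^sub>R v"
    unfolding K L M N by (simp_all add: algebra_simps)
  have "perimeter A B C D \<mu> = 2 * \<bar>r\<bar> * (norm u + norm v)"
    unfolding perimeter_def dist_norm sides by (simp add: algebra_simps)
  then show ?thesis by (simp add: r_def uv abs_minus_commute)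
qed

theorem corollary3:
  fixes A B C D :: point and \<mu>\<^sub>1 \<mu>\<^sub>2 :: real
  assumes "quadrangle A B C D"
    and "\<not> affine_parallel (line A C) (line B D)"
  shows "(\<mu>\<^sub>2 \<noteq> 1 \<longrightarrow>
            perimeter A B C D \<mu>\<^sub>2 \<noteq> 0 \<and>
            perimeter A B C D \<mu>\<^sub>1 / perimeter A B C D \<mu>\<^sub>2 = \<bar>\<mu>\<^sub>1 - 1\<bar> / \<bar>\<mu>\<^sub>2 - 1\<bar>) \<and>
         (\<mu>\<^sub>2 = 1 \<longrightarrow>
            perimeter A B C D \<mu>\<^sub>2 = 0 \<and>
            perimeter A B C D \<mu>\<^sub>1 * \<bar>\<mu>\<^sub>2 - 1\<bar> = perimeter A B C D \<mu>\<^sub>2 * \<bar>\<mu>\<^sub>1 - 1\<bar>)"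
proof -
  have "A \<noteq> C" "B \<noteq> D"
    using assms(1) by (auto simp: quadrangle_def insert_commute)
  have nopar: "D - B \<noteq> k *\<^sub>R (C - A)" for k
    using assms(2) line_affine_parallel[of D B k C A] \<open>B \<noteq> D\<close> by (cases "k = 0") auto
  \<comment> \<open>This is the case \<open>k = 1\<close> of \<open>nopar\<close>.\<close>
  then have "C - A \<noteq> D - B" by (metis scaleR_one)
  have "independent {D - B, C - A}"
    using nopar \<open>A \<noteq> C\<close> by (auto simp: independent_insert span_singleton)
  then have per: "perimeter A B C D \<mu> = 2 * \<bar>\<mu> - 1\<bar> * (norm (C - A) + norm (D - B))" for \<mu>
    using \<open>C - A \<noteq> D - B\<close> by (intro perimeter_eq) (simp_all add: insert_commute)
  \<comment> \<open>Positivity of this factor makes the perimeter vanish only at ratio 1 and lets it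
    cancel in the quotient.\<close>
  have "norm (C - A) + norm (D - B) > 0"
    using \<open>A \<noteq> C\<close> by (simp add: add_pos_nonneg)
  then show ?thesis
    unfolding per by simp
qed

end
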